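(* $R_1^{\Delta}(4,6)=10$, and up to isomorphism the unique extremal graph is the graph $H$ with vertex set $\{v_1,\dots,v_9\}$ and edge set $\{v_1v_2, v_2v_3, v_3v_8, v_4v_5, v_5v_6, v_6v_7, v_7v_8, v_8v_9, v_1v_4, v_4v_9, v_2v_6\}$. That is, every triangle-free graph on $10$ vertices contains a $1$-dense set of $4$ vertices or a $1$-sparse set of $6$ vertices, and $H$ is, up to isomorphism, the only triangle-free graph on $9$ vertices containing neither.
   Context: All graphs are finite and simple. For an integer $k\ge0$, a set $S$ of vertices of a graph $G$ is $k$-sparse if the induced subgraph $G[S]$ has maximum degree at most $k$, and $k$-dense if every vertex of $S$ is non-adjacent to at most $k$ other vertices of $S$. $R_k^{\Delta}(i,j)$ denotes the least $n$ such that every triangle-free graph on $n$ vertices contains a $k$-dense set of $i$ vertices or a $k$-sparse set of $j$ vertices. An extremal graph for $R_k^{\Delta}(i,j)$ is a triangle-free graph on $R_k^{\Delta}(i,j)-1$ vertices containing neither a $k$-dense set of $i$ vertices nor a $k$-sparse set of $j$ vertices. *)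

theory Defs
  imports "Graph_Theory.Graph_Theory"
begin

text \<open>Finite simple graphs are rendered by the locale \<^verbatim>\<open>pair_graph\<close>: a finite vertex set
  with a symmetric irreflexive adjacency relation on it. An undirected edge \<open>uv\<close> is thus the
  pair of arcs \<open>(u, v)\<close> and \<open>(v, u)\<close>, and the degree of a vertex is its out-degree.\<close>

definition triangle_free :: "'a pair_pre_digraph \<Rightarrow> bool" where
  "triangle_free G \<longleftrightarrow>
    \<not> (\<exists>u v w. (u, v) \<in> parcs G \<and> (v, w) \<in> parcs G \<and> (w, u) \<in> parcs G)"

definition sparse_set :: "nat \<Rightarrow> 'a pair_pre_digraph \<Rightarrow> 'a set \<Rightarrow> bool" where
  "sparse_set k G S \<longleftrightarrow>
    S \<subseteq> pverts G \<and> (\<forall>v\<in>S. out_degree (with_proj G \<restriction> S) v \<le> k)"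

definition dense_set :: "nat \<Rightarrow> 'a pair_pre_digraph \<Rightarrow> 'a set \<Rightarrow> bool" where
  "dense_set k G S \<longleftrightarrow>
    S \<subseteq> pverts G \<and> (\<forall>v\<in>S. card {u \<in> S. u \<noteq> v \<and> (v, u) \<notin> parcs G} \<le> k)"

definition has_dense_or_sparse :: "nat \<Rightarrow> nat \<Rightarrow> nat \<Rightarrow> 'a pair_pre_digraph \<Rightarrow> bool" where
  "has_dense_or_sparse k i j G \<longleftrightarrow>
    (\<exists>S. dense_set k G S \<and> card S = i) \<or> (\<exists>S. sparse_set k G S \<and> card S = j)"

text \<open>A closed definition has to fix the vertex type. Since every finite graph is isomorphic to one
  whose vertices are natural numbers, quantifying over graphs on \<^typ>\<open>nat\<close> loses nothing.\<close>

definition ramsey_tf :: "nat \<Rightarrow> nat \<Rightarrow> nat \<Rightarrow> nat" where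
  "ramsey_tf k i j =
    (LEAST n. \<forall>G :: nat pair_pre_digraph.
      pair_graph G \<and> triangle_free G \<and> card (pverts G) = n \<longrightarrow> has_dense_or_sparse k i j G)"

definition extremal_graph :: "nat \<Rightarrow> nat \<Rightarrow> nat \<Rightarrow> 'a pair_pre_digraph \<Rightarrow> bool" where
  "extremal_graph k i j G \<longleftrightarrow>
    pair_graph G \<and> triangle_free G \<and> card (pverts G) = ramsey_tf k i j - 1 \<and>
    \<not> has_dense_or_sparse k i j G"

definition H_edges :: "(nat \<times> nat) set" where
  "H_edges = {(1,2), (2,3), (3,8), (4,5), (5,6), (6,7), (7,8), (8,9), (1,4), (4,9), (2,6)}"

definition graph_H :: "nat pair_pre_digraph" where
  "graph_H = \<lparr> pverts = {1..9}, parcs = H_edges \<union> H_edges\<inverse> \<rparr>"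

end

theory Submission
  imports Defs
begin

text \<open>In a triangle-free graph a \<open>1\<close>-dense set of four vertices is a \<open>4\<close>-cycle, so the graphs in
  question have girth at least five. On nine vertices, look at the neighbourhood of a vertex of
  maximum degree: degrees above three and below three are impossible, every neighbour of a vertex of
  degree three has a further neighbour, and the remaining configuration leaves only copies of \<open>H\<close>.
  Once the nine vertices have been named, each of these claims is propositional.
  On ten vertices, every vertex-deleted subgraph is a copy of \<open>H\<close> and has \<open>22\<close> arcs; every
  arc survives in eight of these subgraphs, so the number of arcs is \<open>220 / 8\<close>, which is not
  an integer.\<close>

section \<open>Enumerating the subsets of a list\<close>

fun combs :: "nat \<Rightarrow> 'a list \<Rightarrow> 'a list list" where
  "combs 0 xs = [[]]"
| "combs (Suc k) [] = []"
| "combs (Suc k) (x # xs) = map ((#) x) (combs k xs) @ combs (Suc k) xs"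

lemma combs_sound:
  "ys \<in> set (combs k xs) \<Longrightarrow> distinct xs \<Longrightarrow> distinct ys \<and> length ys = k \<and> set ys \<subseteq> set xs"
  by (induction k xs arbitrary: ys rule: combs.induct) fastforce+

text \<open>Turns a quantifier over all \<open>k\<close>-subsets into one over a concrete list. This
  serves the clauses for an unknown graph as well as the exhaustive checks on
  \<open>graph_H\<close>.\<close>

lemma combs_complete:
  "distinct xs \<Longrightarrow> A \<subseteq> set xs \<Longrightarrow> card A = k \<Longrightarrow> \<exists>ys\<in>set (combs k xs). set ys = A"
proof (induction k xs arbitrary: A rule: combs.induct)
  case (1 xs)
  then have "finite A" by (meson finite_set finite_subset)
  with 1 show ?case by simp
next
  case (2 k)
  then show ?case by auto
next
  case (3 k x xs)
  show ?case
  proof (cases "x \<in> A")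
    case True
    have "A - {x} \<subseteq> set xs" "card (A - {x}) = k" "distinct xs"
      using "3.prems" True by auto
    then obtain ys where "ys \<in> set (combs k xs)" "set ys = A - {x}"
      using "3.IH"(1) by blast
    then have "x # ys \<in> set (combs (Suc k) (x # xs))" "set (x # ys) = A"
      using True by auto
    then show ?thesis by blast
  next
    case False
    then have "A \<subseteq> set xs" "distinct xs" using "3.prems" by auto
    then obtain ys where "ys \<in> set (combs (Suc k) xs)" "set ys = A"
      using "3.IH"(2) "3.prems"(3) by blast
    then show ?thesis by auto
  qed
qed

section \<open>Nine-vertex graphs of girth at least five and their clauses\<close>

definition cherry :: "('a \<Rightarrow> 'a \<Rightarrow> bool) \<Rightarrow> 'a list \<Rightarrow> bool" where
  "cherry E T \<longleftrightarrow> (\<exists>x\<in>set T. \<exists>y\<in>set T. \<exists>z\<in>set T. y \<noteq> z \<and> E x y \<and> E x z)"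

text \<open>Only the edges of \<open>H\<close> are required: in a graph of girth five on nine vertices the other pairs
  are then at distance two or three and hence non-adjacent.\<close>

fun H_copy :: "('a \<Rightarrow> 'a \<Rightarrow> bool) \<Rightarrow> 'a list \<Rightarrow> bool" where
  "H_copy E [v1, v2, v3, v4, v5, v6, v7, v8, v9] \<longleftrightarrow>
     E v1 v2 \<and> E v2 v3 \<and> E v3 v8 \<and> E v4 v5 \<and> E v5 v6 \<and> E v6 v7 \<and> E v7 v8 \<and> E v8 v9 \<and>
     E v1 v4 \<and> E v4 v9 \<and> E v2 v6"
| "H_copy E _ \<longleftrightarrow> False"

lemma parcs_graph_H:
  "parcs graph_H = {(2, 1), (3, 2), (8, 3), (5, 4), (6, 5), (7, 6), (8, 7), (9, 8),
     (4, 1), (9, 4), (6, 2), (1, 2), (2, 3), (3, 8), (4, 5), (5, 6), (6, 7), (7, 8), (8, 9),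
     (1, 4), (4, 9), (2, 6)}"
proof -
  have "(insert (a, b) r)\<inverse> = insert (b, a) (r\<inverse>)" for a b :: nat and r
    by auto
  then show ?thesis
    unfolding graph_H_def H_edges_def by simp
qed

text \<open>\<open>no_square\<close> encodes the absence of 1-dense 4-sets, \<open>no_sparse\<close>
  that of 1-sparse 6-sets: a set fails to be 1-sparse when one of its vertices has two neighbours in
  it. Adjacency is a bare predicate, so that its instances can act as propositional atoms.\<close>

locale nine_graph =
  fixes E :: "'a \<Rightarrow> 'a \<Rightarrow> bool" and V :: "'a set"
  assumes card_V: "card V = 9"
    and wf: "E x y \<Longrightarrow> x \<in> V"
    and sym: "E x y \<Longrightarrow> E y x"
    and no_triangle: "\<not> (E x y \<and> E y z \<and> E z x)"
    and no_square: "x \<noteq> z \<Longrightarrow> y \<noteq> w \<Longrightarrow> \<not> (E x y \<and> E y z \<and> E z w \<and> E w x)"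
    and no_sparse: "S \<subseteq> V \<Longrightarrow> card S = 6 \<Longrightarrow>
        \<exists>x\<in>S. \<exists>y\<in>S. \<exists>z\<in>S. y \<noteq> z \<and> E x y \<and> E x z"
begin

text \<open>A loop would be a triangle whose three vertices coincide.\<close>

lemma irrefl: "\<not> E x x"
  using no_triangle by blast

text \<open>The following facts become propositional clauses once \<open>vs\<close> is an explicit list. They only
  use atoms \<open>E x y\<close> with \<open>x\<close> before \<open>y\<close> in \<open>vs\<close>, and \<^const>\<open>cherry\<close> stays an opaque atom, which keeps
  the disjunctions for the \<open>6\<close>-sets short.\<close>

lemma six_clauses:
  assumes "distinct vs" "set vs \<subseteq> V"
  shows "\<forall>S\<in>set (combs 6 vs). \<exists>T\<in>set (combs 3 S). cherry E T"
proof
  fix S assume "S \<in> set (combs 6 vs)"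
  then have S: "distinct S" "length S = 6" "set S \<subseteq> set vs"
    using combs_sound assms(1) by metis+
  then obtain x y z where xyz: "x \<in> set S" "y \<in> set S" "z \<in> set S" "y \<noteq> z" "E x y" "E x z"
    using no_sparse[of "set S"] assms(2) distinct_card[OF S(1)] by (metis order_trans)
  then have "x \<noteq> y" "x \<noteq> z" using irrefl by auto
  with xyz have "card {x, y, z} = 3" "{x, y, z} \<subseteq> set S" by auto
  then obtain T where "T \<in> set (combs 3 S)" "set T = {x, y, z}"
    using combs_complete S(1) by metis
  with xyz show "\<exists>T\<in>set (combs 3 S). cherry E T"
    unfolding cherry_def by blast
qed

text \<open>A cherry on three vertices uses at least two of the three pairs; in conjunctive form,
  any two of the pairs include an edge. One implication suffices because \<open>cherry\<close>
  occurs only positively in \<open>six_clauses\<close>.\<close>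

lemma three_clauses:
  assumes "distinct vs"
  shows "\<forall>T\<in>set (combs 3 vs). case T of [x, y, z] \<Rightarrow>
    \<not> (E x y \<and> E x z \<and> E y z) \<and>
    (cherry E [x, y, z] \<longrightarrow> (E x y \<or> E x z) \<and> (E x y \<or> E y z) \<and> (E x z \<or> E y z)) | _ \<Rightarrow> True"
proof
  fix T assume "T \<in> set (combs 3 vs)"
  then obtain x y z where T: "T = [x, y, z]"
    using combs_sound[of T 3 vs] assms by (auto simp: length_Suc_conv numeral_eq_Suc)
  have "\<not> (E x y \<and> E x z \<and> E y z)"
    using no_triangle sym by blast
  moreover have "cherry E [x, y, z] \<longrightarrow> (E x y \<or> E x z) \<and> (E x y \<or> E y z) \<and> (E x z \<or> E y z)"
    unfolding cherry_def using irrefl sym by auto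
  ultimately show "case T of [x, y, z] \<Rightarrow>
    \<not> (E x y \<and> E x z \<and> E y z) \<and>
    (cherry E [x, y, z] \<longrightarrow> (E x y \<or> E x z) \<and> (E x y \<or> E y z) \<and> (E x z \<or> E y z)) | _ \<Rightarrow> True"
    by (simp add: T)
qed

text \<open>Four vertices have three cyclic orders, hence three possible 4-cycles.\<close>

lemma four_clauses:
  assumes "distinct vs"
  shows "\<forall>T\<in>set (combs 4 vs). case T of [x, y, z, w] \<Rightarrow>
    \<not> (E x y \<and> E y z \<and> E z w \<and> E x w) \<and>
    \<not> (E x y \<and> E y w \<and> E z w \<and> E x z) \<and>
    \<not> (E x z \<and> E y z \<and> E y w \<and> E x w) | _ \<Rightarrow> True"
proof
  fix T assume "T \<in> set (combs 4 vs)"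
  then obtain x y z w where T: "T = [x, y, z, w]" and "distinct [x, y, z, w]"
    using combs_sound[of T 4 vs] assms by (auto simp: length_Suc_conv numeral_eq_Suc)
  then have "\<not> (E x y \<and> E y z \<and> E z w \<and> E x w)" "\<not> (E x y \<and> E y w \<and> E z w \<and> E x z)"
    "\<not> (E x z \<and> E y z \<and> E y w \<and> E x w)"
    using no_square[of x z y w] no_square[of x w y z] no_square[of x y z w] sym by auto
  then show "case T of [x, y, z, w] \<Rightarrow>
    \<not> (E x y \<and> E y z \<and> E z w \<and> E x w) \<and>
    \<not> (E x y \<and> E y w \<and> E z w \<and> E x z) \<and>
    \<not> (E x z \<and> E y z \<and> E y w \<and> E x w) | _ \<Rightarrow> True"
    by (simp add: T)
qed

section \<open>Excluding local configurations propositionally\<close>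

lemmas clauses = six_clauses three_clauses four_clauses

text \<open>By hand: \<open>a\<close>, \<open>b\<close>, \<open>c\<close>, \<open>d\<close> are
  independent, and each of \<open>p\<close>, \<open>q\<close>, \<open>r\<close> sees at most one of
  them. Adding two of \<open>p\<close>, \<open>q\<close>, \<open>r\<close> to these four shows that
  the two are adjacent or share a neighbour among the four. Without triangles and squares all three
  must hang on the same neighbour, say \<open>a\<close>, and then \<open>b\<close>,
  \<open>c\<close>, \<open>d\<close>, \<open>p\<close>, \<open>q\<close>, \<open>r\<close> are
  independent.\<close>

lemma no_degree_four:
  assumes "distinct [v, a, b, c, d, p, q, r]" "set [v, a, b, c, d, p, q, r] \<subseteq> V"
    and "E v a" "E v b" "E v c" "E v d"
  shows False
  using clauses[OF assms(1)] assms(2-)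
  \<comment> \<open>\<open>eval_nat_numeral\<close> lets \<open>combs\<close> unfold into explicit
    lists. The deleted rules would push negations inward; without them the clauses reach
    \<open>sat\<close> as stated.\<close>
  by (simp add: eval_nat_numeral del: de_Morgan_conj de_Morgan_disj not_all not_ex) sat

text \<open>By hand: \<open>c\<close> has no neighbour but \<open>v\<close>, so the 6-sets made of
  \<open>c\<close>, \<open>v\<close> and four of \<open>p\<close>, ..., \<open>t\<close> force these
  five to induce a 5-cycle. Each of \<open>a\<close>, \<open>b\<close> meets that cycle at most
  once, in different vertices, so some edge of the cycle and the vertex opposite to it extend
  \<open>a\<close>, \<open>b\<close>, \<open>c\<close> to a 1-sparse 6-set.\<close>

lemma no_leaf_neighbour:
  assumes "distinct [v, a, b, c, p, q, r, s, t]" "set [v, a, b, c, p, q, r, s, t] \<subseteq> V"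
    and "E v a" "E v b" "E v c"
    and "list_all (\<lambda>x. \<not> E v x) [p, q, r, s, t]" "list_all (\<lambda>x. \<not> E c x) [p, q, r, s, t]"
  shows False
  using clauses[OF assms(1)] assms(2-)
  by (simp add: eval_nat_numeral del: de_Morgan_conj de_Morgan_disj not_all not_ex) sat

text \<open>One clause for each choice of the centre of a claw on four vertices.\<close>

lemma degree_clauses:
  assumes "\<And>x y z w. distinct [x, y, z, w] \<Longrightarrow> \<not> (E x y \<and> E x z \<and> E x w)" "distinct vs"
  shows "\<forall>T\<in>set (combs 4 vs). case T of [x, y, z, w] \<Rightarrow>
    \<not> (E x y \<and> E x z \<and> E x w) \<and> \<not> (E x y \<and> E y z \<and> E y w) \<and>
    \<not> (E x z \<and> E y z \<and> E z w) \<and> \<not> (E x w \<and> E y w \<and> E z w) | _ \<Rightarrow> True"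
proof
  fix T assume "T \<in> set (combs 4 vs)"
  then obtain x y z w where T: "T = [x, y, z, w]" and "distinct [x, y, z, w]"
    using combs_sound[of T 4 vs] assms(2) by (auto simp: length_Suc_conv numeral_eq_Suc)
  then have "\<not> (E x y \<and> E x z \<and> E x w)" "\<not> (E x y \<and> E y z \<and> E y w)"
    "\<not> (E x z \<and> E y z \<and> E z w)" "\<not> (E x w \<and> E y w \<and> E z w)"
    using assms(1)[of x y z w] assms(1)[of y x z w] assms(1)[of z x y w] assms(1)[of w x y z] sym
    by auto
  then show "case T of [x, y, z, w] \<Rightarrow>
    \<not> (E x y \<and> E x z \<and> E x w) \<and> \<not> (E x y \<and> E y z \<and> E y w) \<and>
    \<not> (E x z \<and> E y z \<and> E z w) \<and> \<not> (E x w \<and> E y w \<and> E z w) | _ \<Rightarrow> True"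
    by (simp add: T)
qed

text \<open>By hand: the components are paths and at most one cycle, since two cycles of length at
  least five need ten vertices. Deleting at most three vertices leaves pieces of at most two
  vertices, hence a 1-sparse 6-set. Fixing two neighbours of \<open>v\<close> breaks the
  symmetry.\<close>

lemma max_degree_not_two:
  assumes "\<And>x y z w. distinct [x, y, z, w] \<Longrightarrow> \<not> (E x y \<and> E x z \<and> E x w)"
    and "distinct [v, a, b, p, q, r, s, t, u]" "set [v, a, b, p, q, r, s, t, u] \<subseteq> V" "E v a" "E v b"
  shows False
  using clauses[OF assms(2)] degree_clauses[OF assms(1,2)] assms(2-)
  by (simp add: eval_nat_numeral del: de_Morgan_conj de_Morgan_disj not_all not_ex) sat

text \<open>The copies of \<open>H\<close> in the next lemma mention edges in both orientations, the
  other clauses only in list order; this links the two.\<close>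

lemma pair_clauses:
  "\<forall>T\<in>set (combs 2 vs). case T of [x, y] \<Rightarrow> E x y \<longrightarrow> E y x | _ \<Rightarrow> True"
  using sym by (auto split: list.split)

text \<open>The known edges form a three-edge star at \<open>v\<close> with every edge subdivided
  or, equivalently, three paths of length two from \<open>v\<close>; \<open>s\<close> and
  \<open>t\<close> are the two vertices left over. Every way to satisfy the clauses contains one of
  finitely many named copies of \<open>H\<close>.\<close>

lemma degree_three:
  assumes "distinct [v, a, b, c, p, q, r, s, t]" "set [v, a, b, c, p, q, r, s, t] = V"
    and "E v a" "E v b" "E v c" "E a p" "E b q" "E c r"
    and "list_all (\<lambda>x. \<not> E v x) [p, q, r, s, t]"
  shows "\<exists>xs. distinct xs \<and> set xs = V \<and> H_copy E xs"
proof (rule ccontr)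
  assume no_H: "\<not> ?thesis"
  \<comment> \<open>These are the \<open>18\<close> ways, up to automorphisms of \<open>H\<close>, to complete the known edges to a copy.\<close>
  have "list_all (\<lambda>xs. \<not> H_copy E xs)
   [[a, v, b, p, r, c, s, q, t], [a, v, b, p, r, c, t, q, s], [a, v, b, p, s, c, r, q, t],
    [a, v, b, p, t, c, r, q, s], [a, v, c, p, q, b, s, r, t], [a, v, c, p, q, b, t, r, s],
    [a, v, c, p, s, b, q, r, t], [a, v, c, p, t, b, q, r, s], [a, p, s, v, b, q, t, r, c],
    [a, p, s, v, c, r, t, q, b], [a, p, t, v, b, q, s, r, c], [a, p, t, v, c, r, s, q, b],
    [b, v, c, q, p, a, s, r, t], [b, v, c, q, p, a, t, r, s], [b, v, c, q, s, a, p, r, t],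
    [b, v, c, q, t, a, p, r, s], [b, q, s, v, c, r, t, p, a], [b, q, t, v, c, r, s, p, a]]"
    (is "list_all _ ?xss")
  proof -
    have "list_all (\<lambda>xs. distinct xs \<and> set xs = V) ?xss"
      using assms(1) unfolding assms(2)[symmetric] by (auto simp: insert_commute)
    then show ?thesis using no_H by (auto simp: list_all_iff simp del: H_copy.simps)
  qed
  then show False
    using six_clauses[OF assms(1) equalityD1[OF assms(2)]] three_clauses[OF assms(1)]
      four_clauses[OF assms(1)] pair_clauses[of "[v, a, b, c, p, q, r, s, t]"] assms(3-)
    by (simp add: eval_nat_numeral del: de_Morgan_conj de_Morgan_disj not_all not_ex) sat
qed

section \<open>Naming the vertices and finding a copy of \<open>H\<close>\<close>

lemma extend_list:
  assumes "distinct ys" "set ys \<subseteq> V"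
  obtains zs where "length zs = 9 - length ys" "distinct (ys @ zs)" "set (ys @ zs) = V"
proof -
  have fin: "finite V"
    using card_V by (simp add: card_ge_0_finite)
  then obtain zs where zs: "set zs = V - set ys" "distinct zs"
    using finite_distinct_list[of "V - set ys"] by auto
  have "length zs = card V - card (set ys)"
    using zs assms(2) fin by (metis card_Diff_subset distinct_card finite_set)
  then have "length zs = 9 - length ys"
    using card_V assms(1) distinct_card by metis
  moreover have "distinct (ys @ zs)" "set (ys @ zs) = V"
    using zs assms by auto
  ultimately show ?thesis
    using that by blast
qed

lemma ex_H_copy: "\<exists>xs. distinct xs \<and> set xs = V \<and> H_copy E xs"
proof -
  have in_V: "x \<in> V" "y \<in> V" if "E x y" for x y
    using wf[OF that] wf[OF sym[OF that]] .
  have no_deg4: False if v: "E v a" "E v b" "E v c" "E v d" "distinct [a, b, c, d]" for v a b c d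
  proof -
    have ys: "distinct [v, a, b, c, d]" "set [v, a, b, c, d] \<subseteq> V"
      using v irrefl in_V by auto
    obtain zs where "length zs = 4" "distinct ([v, a, b, c, d] @ zs)" "set ([v, a, b, c, d] @ zs) = V"
      by (rule extend_list[OF ys]) simp
    moreover from this obtain p q r s where "zs = [p, q, r, s]"
      by (auto simp: length_Suc_conv numeral_eq_Suc)
    ultimately show False
      using no_degree_four[of v a b c d p q r] v(1-4) by auto
  qed
  have "\<exists>v a b c. E v a \<and> E v b \<and> E v c \<and> distinct [a, b, c]"
  proof (rule ccontr)
    assume no3: "\<not> ?thesis"
    \<comment> \<open>Any 6-set will do: \<open>no_sparse\<close> finds in it a vertex with two
      neighbours, the start required by \<open>max_degree_not_two\<close>.\<close>
    obtain S where "S \<subseteq> V" "card S = 6"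
      using card_V obtain_subset_with_card_n[of 6 V] by auto
    then obtain v a b where vab: "E v a" "E v b" "a \<noteq> b"
      using no_sparse by blast
    have ys: "distinct [v, a, b]" "set [v, a, b] \<subseteq> V"
      using vab irrefl in_V by auto
    obtain zs where "length zs = 6" "distinct ([v, a, b] @ zs)" "set ([v, a, b] @ zs) = V"
      by (rule extend_list[OF ys]) simp
    moreover from this obtain p q r s t u where "zs = [p, q, r, s, t, u]"
      by (auto simp: length_Suc_conv numeral_eq_Suc)
    moreover have "\<not> (E x y \<and> E x z \<and> E x w)" if "distinct [x, y, z, w]" for x y z w
      using no3 that by auto
    ultimately show False
      using max_degree_not_two[of v a b p q r s t u] vab by auto
  qed
  then obtain v a b c where v: "E v a" "E v b" "E v c" "distinct [a, b, c]"
    by blast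
  have nbrs: "x \<in> {a, b, c}" if "E v x" for x
    using no_deg4[of v a b c x] v that by auto
  have indep: "\<not> E x y" if "x \<in> {a, b, c}" "y \<in> {a, b, c}" for x y
    using that v no_triangle sym by blast
  \<comment> \<open>Stated for every ordering of \<open>a\<close>, \<open>b\<close>,
    \<open>c\<close>, so that each of them can take the role of the suspected leaf.\<close>
  have outer: "\<exists>p. p \<noteq> v \<and> E z p"
    if xyz: "distinct [x, y, z]" "{x, y, z} = {a, b, c}" for x y z
  proof (rule ccontr)
    assume "\<not> ?thesis"
    then have no_p: "\<not> E z u" if "u \<noteq> v" for u
      using that by blast
    have nbrs': "u \<in> {x, y, z}" if "E v u" for u
      using nbrs[OF that] xyz(2) by simp
    have "E v x" "E v y" "E v z"
      using v(1-3) xyz(2) by auto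
    then have ys: "distinct [v, x, y, z]" "set [v, x, y, z] \<subseteq> V"
      using xyz(1) irrefl in_V by auto
    obtain zs where "length zs = 5" "distinct ([v, x, y, z] @ zs)" "set ([v, x, y, z] @ zs) = V"
      by (rule extend_list[OF ys]) simp
    moreover from this obtain p q r s t where "zs = [p, q, r, s, t]"
      by (auto simp: length_Suc_conv numeral_eq_Suc)
    moreover from calculation have "list_all (\<lambda>u. \<not> E v u) zs" "list_all (\<lambda>u. \<not> E z u) zs"
      using nbrs' no_p by (auto simp: list_all_iff)
    ultimately show False
      using no_leaf_neighbour[of v x y z p q r s t] \<open>E v x\<close> \<open>E v y\<close> \<open>E v z\<close> by auto
  qed
  obtain p where p: "p \<noteq> v" "E a p" using outer[of b c a] v(4) by auto
  obtain q where q: "q \<noteq> v" "E b q" using outer[of a c b] v(4) by auto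
  obtain r where r: "r \<noteq> v" "E c r" using outer[of a b c] v(4) by auto
  have "p \<notin> {a, b, c}" "q \<notin> {a, b, c}" "r \<notin> {a, b, c}"
    using p q r indep by blast+
  \<comment> \<open>A common outer neighbour of two of \<open>a\<close>, \<open>b\<close>,
    \<open>c\<close> would close a 4-cycle through \<open>v\<close>.\<close>
  moreover have "distinct [p, q, r]"
    using no_square[of v p a b] no_square[of v q b c] no_square[of v p a c] p q r v sym by auto
  ultimately have ys: "distinct [v, a, b, c, p, q, r]" "set [v, a, b, c, p, q, r] \<subseteq> V"
    using p q r v irrefl in_V by auto
  obtain zs where "length zs = 2" "distinct ([v, a, b, c, p, q, r] @ zs)"
    "set ([v, a, b, c, p, q, r] @ zs) = V"
    by (rule extend_list[OF ys]) simp
  moreover from this obtain s t where "zs = [s, t]"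
    by (auto simp: length_Suc_conv numeral_eq_Suc)
  moreover from calculation have "list_all (\<lambda>u. \<not> E v u) [p, q, r, s, t]"
    using nbrs by (auto simp: list_all_iff)
  ultimately show ?thesis
    using degree_three[of v a b c p q r s t] v p q r by simp
qed

text \<open>The shift \<open>i - 1\<close> matches the vertices 1 to 9 of \<open>graph_H\<close>
  with the list positions 0 to 8.\<close>

lemma H_copy_arcs:
  assumes "distinct xs" "set xs = V" "H_copy E xs"
  shows "{(x, y). E x y} = map_prod (\<lambda>i. xs ! (i - 1)) (\<lambda>i. xs ! (i - 1)) ` parcs graph_H"
proof -
  have "length xs = 9"
    using assms(1,2) card_V distinct_card by metis
  then obtain v1 v2 v3 v4 v5 v6 v7 v8 v9 where xs: "xs = [v1, v2, v3, v4, v5, v6, v7, v8, v9]"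
    by (auto simp: length_Suc_conv numeral_eq_Suc)
  note copy = assms(3)[unfolded xs H_copy.simps]
  \<comment> \<open>All 25 non-edges of \<open>H\<close>: each would close a triangle or a 4-cycle
    with edges of the copy.\<close>
  have non_edges: "list_all (\<lambda>(x, y). \<not> E x y)
    [(v1, v3), (v1, v5), (v1, v6), (v1, v7), (v1, v8), (v1, v9), (v2, v4), (v2, v5), (v2, v7),
     (v2, v8), (v2, v9), (v3, v4), (v3, v5), (v3, v6), (v3, v7), (v3, v9), (v4, v6), (v4, v7),
     (v4, v8), (v5, v7), (v5, v8), (v5, v9), (v6, v8), (v6, v9), (v7, v9)]"
    using three_clauses[OF assms(1)] four_clauses[OF assms(1)] copy unfolding xs
    by (simp add: eval_nat_numeral)
  have img: "map_prod (\<lambda>i. xs ! (i - 1)) (\<lambda>i. xs ! (i - 1)) ` parcs graph_H =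
    {(v2, v1), (v3, v2), (v8, v3), (v5, v4), (v6, v5), (v7, v6), (v8, v7), (v9, v8),
     (v4, v1), (v9, v4), (v6, v2), (v1, v2), (v2, v3), (v3, v8), (v4, v5), (v5, v6),
     (v6, v7), (v7, v8), (v8, v9), (v1, v4), (v4, v9), (v2, v6)}" (is "_ = ?A")
    unfolding parcs_graph_H xs by simp
  have sub: "(x, y) \<in> ?A" if "E x y" for x y
  proof -
    have "x \<in> set xs" "y \<in> set xs"
      using that wf sym assms(2) by blast+
    moreover have "E y x" "x \<noteq> y"
      using that sym irrefl by auto
    ultimately show ?thesis
      using that non_edges unfolding xs by (simp, elim disjE; simp)
  qed
  have sup: "E x y" if "(x, y) \<in> ?A" for x y
  proof -
    have "list_all (\<lambda>(x, y). E x y \<and> E y x)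
      [(v1, v2), (v2, v3), (v3, v8), (v4, v5), (v5, v6), (v6, v7), (v7, v8), (v8, v9),
       (v1, v4), (v4, v9), (v2, v6)]"
      using copy sym by simp
    then show ?thesis
      using that by (simp, elim disjE; simp)
  qed
  show ?thesis
    unfolding img
  proof (intro equalityI subsetI)
    show "e \<in> ?A" if "e \<in> {(x, y). E x y}" for e
      using sub[of "fst e" "snd e"] that by (simp only: case_prod_unfold mem_Collect_eq prod.collapse)
    show "e \<in> {(x, y). E x y}" if "e \<in> ?A" for e
      using sup[of "fst e" "snd e"] that by (simp only: case_prod_unfold mem_Collect_eq prod.collapse)
  qed
qed

end

section \<open>Elementary characterisations and induced subgraphs\<close>

lemma out_degree_restrict:
  assumes "v \<in> S"
  shows "out_degree (with_proj G \<restriction> S) v = card {u \<in> S. (v, u) \<in> parcs G}"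
proof -
  have "out_arcs (with_proj G \<restriction> S) v = Pair v ` {u \<in> S. (v, u) \<in> parcs G}"
    using assms unfolding out_arcs_def by auto
  then show ?thesis
    unfolding out_degree_def by (simp add: card_image inj_on_def)
qed

lemma sparse_set_iff:
  "sparse_set k G S \<longleftrightarrow>
    S \<subseteq> pverts G \<and> (\<forall>v\<in>S. card {u \<in> S. (v, u) \<in> parcs G} \<le> k)"
  unfolding sparse_set_def by (auto simp: out_degree_restrict)

lemma pair_graph_iff:
  "pair_graph G \<longleftrightarrow> finite (pverts G) \<and> parcs G \<subseteq> pverts G \<times> pverts G \<and>
    (\<forall>x y. (x, y) \<in> parcs G \<longrightarrow> (y, x) \<in> parcs G \<and> x \<noteq> y)"
proof
  assume "pair_graph G"
  then interpret pair_graph G .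
  show "finite (pverts G) \<and> parcs G \<subseteq> pverts G \<times> pverts G \<and>
    (\<forall>x y. (x, y) \<in> parcs G \<longrightarrow> (y, x) \<in> parcs G \<and> x \<noteq> y)"
    using pair_finite_verts in_arcsD1 in_arcsD2 pair_sym_arcs pair_no_loops[of "(x, y)" for x y]
    by (auto simp: symmetric_def dest: symD)
next
  assume *: "finite (pverts G) \<and> parcs G \<subseteq> pverts G \<times> pverts G \<and>
    (\<forall>x y. (x, y) \<in> parcs G \<longrightarrow> (y, x) \<in> parcs G \<and> x \<noteq> y)"
  then have "finite (parcs G)"
    using finite_subset by blast
  with * show "pair_graph G"
    by unfold_locales (auto simp: symmetric_def intro: symI)
qed

definition restrict_verts :: "'a pair_pre_digraph \<Rightarrow> 'a set \<Rightarrow> 'a pair_pre_digraph" where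
  "restrict_verts G W = \<lparr> pverts = W, parcs = parcs G \<inter> W \<times> W \<rparr>"

lemma restrict_verts_simps [simp]:
  "pverts (restrict_verts G W) = W"
  "parcs (restrict_verts G W) = parcs G \<inter> W \<times> W"
  by (simp_all add: restrict_verts_def)

text \<open>Sparseness and density of a set inside \<open>W\<close> depend only on the arcs within
  it. Used to delete a vertex from a ten-vertex graph and to shrink \<open>graph_H\<close> for the
  lower bound.\<close>

lemma restrict_verts_good:
  assumes "pair_graph G" "triangle_free G" "\<not> has_dense_or_sparse k i j G" "W \<subseteq> pverts G"
  shows "pair_graph (restrict_verts G W)" "triangle_free (restrict_verts G W)"
    "\<not> has_dense_or_sparse k i j (restrict_verts G W)"
proof -
  show "pair_graph (restrict_verts G W)"
    using assms(1,4) unfolding pair_graph_iff by (auto dest: finite_subset)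
  show "triangle_free (restrict_verts G W)"
    using assms(2) unfolding triangle_free_def restrict_verts_simps by blast
  have "dense_set k G S" if "dense_set k (restrict_verts G W) S" for S
  proof -
    have "S \<subseteq> W" using that by (simp add: dense_set_def)
    then have "{u \<in> S. u \<noteq> v \<and> (v, u) \<notin> parcs (restrict_verts G W)} =
        {u \<in> S. u \<noteq> v \<and> (v, u) \<notin> parcs G}" if "v \<in> S" for v
      using that by auto
    then show ?thesis
      using that assms(4) by (auto simp: dense_set_def)
  qed
  moreover have "sparse_set k G S" if "sparse_set k (restrict_verts G W) S" for S
  proof -
    have "S \<subseteq> W" using that by (simp add: sparse_set_def)
    then have "{u \<in> S. (v, u) \<in> parcs (restrict_verts G W)} = {u \<in> S. (v, u) \<in> parcs G}"
      if "v \<in> S" for v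
      using that by auto
    then show ?thesis
      using that assms(4) by (auto simp: sparse_set_iff)
  qed
  ultimately show "\<not> has_dense_or_sparse k i j (restrict_verts G W)"
    using assms(3) unfolding has_dense_or_sparse_def by blast
qed

section \<open>Nine-vertex graphs as renamed copies of \<open>H\<close>\<close>

lemma nine_graph_parcs:
  assumes G: "pair_graph G" "triangle_free G" "\<not> has_dense_or_sparse 1 4 6 G"
    and "card (pverts G) = 9"
  shows "nine_graph (\<lambda>x y. (x, y) \<in> parcs G) (pverts G)"
proof
  show "card (pverts G) = 9" by fact
  show "x \<in> pverts G" and "(y, x) \<in> parcs G" if "(x, y) \<in> parcs G" for x y
    using G(1) that unfolding pair_graph_iff by auto
  show "\<not> ((x, y) \<in> parcs G \<and> (y, z) \<in> parcs G \<and> (z, x) \<in> parcs G)" for x y z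
    using G(2) unfolding triangle_free_def by blast
  show "\<not> ((x, y) \<in> parcs G \<and> (y, z) \<in> parcs G \<and> (z, w) \<in> parcs G \<and> (w, x) \<in> parcs G)"
    if "x \<noteq> z" "y \<noteq> w" for x y z w
  proof
    assume sq: "(x, y) \<in> parcs G \<and> (y, z) \<in> parcs G \<and> (z, w) \<in> parcs G \<and> (w, x) \<in> parcs G"
    then have sq': "(y, x) \<in> parcs G" "(z, y) \<in> parcs G" "(w, z) \<in> parcs G" "(x, w) \<in> parcs G"
      and "distinct [x, y, z, w]" "{x, y, z, w} \<subseteq> pverts G"
      using that G(1) unfolding pair_graph_iff by auto
    have "card {u \<in> {x, y, z, w}. u \<noteq> v \<and> (v, u) \<notin> parcs G} \<le> 1" if "v \<in> {x, y, z, w}" for v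
    proof -
      \<comment> \<open>The witness is the vertex opposite to \<open>v\<close> on the
        4-cycle.\<close>
      have "\<exists>t. {u \<in> {x, y, z, w}. u \<noteq> v \<and> (v, u) \<notin> parcs G} \<subseteq> {t}"
        using sq sq' that by auto
      then show ?thesis
        using card_mono[of "{_}"] by fastforce
    qed
    then have "dense_set 1 G {x, y, z, w}"
      using \<open>{x, y, z, w} \<subseteq> pverts G\<close> by (simp add: dense_set_def)
    moreover have "card {x, y, z, w} = 4"
      using \<open>distinct [x, y, z, w]\<close> by simp
    ultimately show False
      using G(3) unfolding has_dense_or_sparse_def by blast
  qed
  show "\<exists>x\<in>S. \<exists>y\<in>S. \<exists>z\<in>S. y \<noteq> z \<and> (x, y) \<in> parcs G \<and> (x, z) \<in> parcs G"
    if S: "S \<subseteq> pverts G" "card S = 6" for S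
  proof -
    have "finite S"
      using S(2) by (simp add: card_ge_0_finite)
    have "\<not> sparse_set 1 G S"
      using G(3) S(2) unfolding has_dense_or_sparse_def by blast
    then obtain x where x: "x \<in> S" "\<not> card {u \<in> S. (x, u) \<in> parcs G} \<le> Suc 0"
      using S(1) by (auto simp: sparse_set_iff)
    moreover have "finite {u \<in> S. (x, u) \<in> parcs G}"
      using \<open>finite S\<close> by simp
    ultimately show ?thesis
      using card_le_Suc0_iff_eq[of "{u \<in> S. (x, u) \<in> parcs G}"] by blast
  qed
qed

text \<open>An equation between arc sets serves twice: for counting arcs and for building the
  isomorphism.\<close>

lemma arcs_eq_map_graph_H:
  assumes "pair_graph G" "triangle_free G" "\<not> has_dense_or_sparse 1 4 6 G"
    and "card (pverts G) = 9"
  obtains g where "bij_betw g {1..9} (pverts G)" "parcs G = map_prod g g ` parcs graph_H"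
proof -
  interpret nine_graph "\<lambda>x y. (x, y) \<in> parcs G" "pverts G"
    using assms by (rule nine_graph_parcs)
  obtain xs where xs: "distinct xs" "set xs = pverts G" "H_copy (\<lambda>x y. (x, y) \<in> parcs G) xs"
    using ex_H_copy by blast
  have len: "length xs = 9"
    using xs(1,2) assms(4) distinct_card by metis
  have "bij_betw (\<lambda>i. i - 1) {1..9::nat} {..<9}"
    by (rule bij_betw_byWitness[where f' = Suc]) auto
  moreover have "bij_betw ((!) xs) {..<9} (pverts G)"
    by (rule bij_betw_nth[OF xs(1)]) (simp_all add: len xs(2))
  ultimately have "bij_betw (\<lambda>i. xs ! (i - 1)) {1..9} (pverts G)"
    unfolding comp_def[symmetric, of "(!) xs" "\<lambda>i. i - 1"] by (rule bij_betw_trans)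
  then show ?thesis
    using that H_copy_arcs[OF xs] by simp
qed

lemma card_arcs_nine:
  assumes "pair_graph G" "triangle_free G" "\<not> has_dense_or_sparse 1 4 6 G"
    and "card (pverts G) = 9"
  shows "card (parcs G) = 22"
proof -
  obtain g where g: "bij_betw g {1..9} (pverts G)" "parcs G = map_prod g g ` parcs graph_H"
    using arcs_eq_map_graph_H assms by blast
  have "parcs graph_H \<subseteq> {1..9} \<times> {1..9}"
    unfolding parcs_graph_H by simp
  moreover have "inj_on (map_prod g g) ({1..9} \<times> {1..9})"
    using g(1) by (intro map_prod_inj_on) (auto simp: bij_betw_def)
  ultimately have "card (parcs G) = card (parcs graph_H)"
    unfolding g(2) by (intro card_image) (rule inj_on_subset)
  then show ?thesis
    unfolding parcs_graph_H by simp
qed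

section \<open>From a bijection of vertices to \<open>digraph_iso\<close>\<close>

lemma with_proj_iso:
  assumes "wf_digraph (with_proj G)" "bij_betw g (pverts H) (pverts G)"
    and "parcs H \<subseteq> pverts H \<times> pverts H" "parcs G = map_prod g g ` parcs H"
  shows "digraph_iso (with_proj G) (with_proj H)"
proof -
  \<comment> \<open>\<open>digraph_iso\<close> asks for a map out of \<open>G\<close>, whereas
    \<open>g\<close> leads into it, hence the inverse.\<close>
  define h where "h = the_inv_into (pverts H) g"
  have hg: "h (g x) = x" if "x \<in> pverts H" for x
    using assms(2) that by (auto simp: h_def bij_betw_def the_inv_into_f_f)
  have hg_arc: "map_prod h h (map_prod g g e) = e" if "e \<in> parcs H" for e
    using that hg assms(3) by (cases e) auto
  have gV: "pverts G = g ` pverts H"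
    using assms(2) by (simp add: bij_betw_def)
  define hom where "hom = \<lparr> iso_verts = h, iso_arcs = map_prod h h, iso_head = snd, iso_tail = fst \<rparr>"
  have "inj_on h (pverts G)"
    unfolding gV using hg by (auto simp: inj_on_def)
  moreover have "inj_on (map_prod h h) (parcs G)"
    unfolding assms(4)
    by (rule inj_on_inverseI[where g = "map_prod g g"], erule imageE) (simp only: hg_arc)
  ultimately have "pre_digraph.digraph_isomorphism (with_proj G) hom"
    using assms(1) unfolding pre_digraph.digraph_isomorphism_def hom_def by simp
  moreover have "h ` pverts G = pverts H"
    unfolding gV using hg by (force simp: image_image)
  moreover have "map_prod h h ` parcs G = parcs H"
    unfolding assms(4) image_image by (simp only: hg_arc image_ident cong: image_cong)
  ultimately show ?thesis
    unfolding digraph_iso_def by (intro exI[of _ hom]) (simp add: app_iso_def hom_def with_proj_def)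
qed

section \<open>Ten vertices\<close>

lemma ten_vertices:
  assumes G: "pair_graph G" "triangle_free G" and "card (pverts G) = 10"
  shows "has_dense_or_sparse 1 4 6 G"
proof (rule ccontr)
  assume no: "\<not> has_dense_or_sparse 1 4 6 G"
  let ?V = "pverts G" and ?A = "parcs G"
  have fin: "finite ?V" and sub: "?A \<subseteq> ?V \<times> ?V"
    and loopfree: "\<forall>x y. (x, y) \<in> ?A \<longrightarrow> x \<noteq> y"
    using G(1) unfolding pair_graph_iff by blast+
  then have fin_arcs: "finite ?A"
    using finite_subset by blast
  have "card {e \<in> ?A. v \<noteq> fst e \<and> v \<noteq> snd e} = 22" if "v \<in> ?V" for v
  proof -
    let ?G' = "restrict_verts G (?V - {v})"
    have "card (parcs ?G') = 22"
      using that assms(3) fin by (intro card_arcs_nine restrict_verts_good[OF G no]) auto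
    moreover have "parcs ?G' = {e \<in> ?A. v \<noteq> fst e \<and> v \<noteq> snd e}"
      using sub by auto
    ultimately show ?thesis by simp
  qed
  then have "(\<Sum>v\<in>?V. card {e \<in> ?A. v \<noteq> fst e \<and> v \<noteq> snd e}) = 220"
    using assms(3) by simp
  \<comment> \<open>Double counting of the pairs formed by an arc and a vertex off that arc.\<close>
  moreover have "(\<Sum>v\<in>?V. card {e \<in> ?A. v \<noteq> fst e \<and> v \<noteq> snd e}) = 8 * card ?A"
  proof (rule sum_multicount[OF fin fin_arcs], rule ballI)
    fix e assume "e \<in> ?A"
    then have "{fst e, snd e} \<subseteq> ?V" "fst e \<noteq> snd e"
      using sub loopfree by (cases e; auto)+
    moreover have "{v \<in> ?V. v \<noteq> fst e \<and> v \<noteq> snd e} = ?V - {fst e, snd e}"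
      by auto
    ultimately show "card {v \<in> ?V. v \<noteq> fst e \<and> v \<noteq> snd e} = 8"
      using assms(3) by (simp add: card_Diff_subset)
  qed
  ultimately show False
    by presburger
qed

section \<open>\<open>H\<close> has no 1-dense 4-set and no 1-sparse 6-set\<close>

text \<open>Membership in an explicit list, so that \<open>code_simp\<close> can evaluate
  adjacency.\<close>

definition H_adj :: "nat \<Rightarrow> nat \<Rightarrow> bool" where
  "H_adj x y \<longleftrightarrow> (x, y) \<in> set [(2, 1), (3, 2), (8, 3), (5, 4), (6, 5), (7, 6), (8, 7), (9, 8),
     (4, 1), (9, 4), (6, 2), (1, 2), (2, 3), (3, 8), (4, 5), (5, 6), (6, 7), (7, 8), (8, 9),
     (1, 4), (4, 9), (2, 6)]"

lemma H_adj_iff: "H_adj x y \<longleftrightarrow> (x, y) \<in> parcs graph_H"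
  unfolding H_adj_def parcs_graph_H by simp

lemma card_filter_distinct:
  "distinct T \<Longrightarrow> card {u \<in> set T. P u} = length (filter P T)"
  by (metis distinct_card distinct_filter set_filter)

text \<open>An exhaustive check: each of the 126 4-sets has a vertex with two non-neighbours in the
  set, and each of the 84 6-sets a vertex with two neighbours in it.\<close>

lemma graph_H_good:
  "pair_graph graph_H" "triangle_free graph_H" "\<not> has_dense_or_sparse 1 4 6 graph_H"
proof -
  have V: "pverts graph_H = set [1..<10]"
    unfolding graph_H_def by auto
  show "pair_graph graph_H"
    unfolding pair_graph_iff V parcs_graph_H by auto
  have "list_all (\<lambda>x. list_all (\<lambda>y. list_all (\<lambda>z. \<not> (H_adj x y \<and> H_adj y z \<and> H_adj z x))
      [1..<10]) [1..<10]) [1..<10]"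
    by code_simp
  moreover have "parcs graph_H \<subseteq> set [1..<10] \<times> set [1..<10]"
    unfolding parcs_graph_H by simp
  ultimately show "triangle_free graph_H"
    unfolding triangle_free_def list_all_iff H_adj_iff by blast
  have "\<not> dense_set 1 graph_H S" if card: "card S = 4" for S
  proof
    assume S: "dense_set 1 graph_H S"
    then have "S \<subseteq> set [1..<10]"
      unfolding dense_set_def V by blast
    then obtain T where T: "T \<in> set (combs 4 [1..<10])" "set T = S"
      using combs_complete[OF distinct_upt _ card] by blast
    have "list_all (\<lambda>T. list_ex (\<lambda>v. 1 < length (filter (\<lambda>u. u \<noteq> v \<and> \<not> H_adj v u) T)) T)
      (combs 4 [1..<10])"
      by code_simp
    then obtain v where v: "v \<in> set T" "1 < length (filter (\<lambda>u. u \<noteq> v \<and> \<not> H_adj v u) T)"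
      using T(1) unfolding list_all_iff list_ex_iff by blast
    have "distinct T"
      using T(1) combs_sound[of T 4 "[1..<10]"] by simp
    then have "1 < card {u \<in> set T. u \<noteq> v \<and> (v, u) \<notin> parcs graph_H}"
      using v(2) by (simp add: card_filter_distinct H_adj_iff)
    then show False
      using S v(1) T(2) unfolding dense_set_def by force
  qed
  moreover have "\<not> sparse_set 1 graph_H S" if card: "card S = 6" for S
  proof
    assume S: "sparse_set 1 graph_H S"
    then have "S \<subseteq> set [1..<10]"
      unfolding sparse_set_def V by blast
    then obtain T where T: "T \<in> set (combs 6 [1..<10])" "set T = S"
      using combs_complete[OF distinct_upt _ card] by blast
    have "list_all (\<lambda>T. list_ex (\<lambda>v. 1 < length (filter (H_adj v) T)) T) (combs 6 [1..<10])"
      by code_simp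
    then obtain v where v: "v \<in> set T" "1 < length (filter (H_adj v) T)"
      using T(1) unfolding list_all_iff list_ex_iff by blast
    have "distinct T"
      using T(1) combs_sound[of T 6 "[1..<10]"] by simp
    then have "1 < card {u \<in> set T. (v, u) \<in> parcs graph_H}"
      using v(2) by (simp add: card_filter_distinct flip: H_adj_iff)
    then show False
      using S v(1) T(2) unfolding sparse_set_iff by force
  qed
  ultimately show "\<not> has_dense_or_sparse 1 4 6 graph_H"
    unfolding has_dense_or_sparse_def by blast
qed

section \<open>The Ramsey number and the extremal graphs\<close>

lemma ramsey_tf_1_4_6: "ramsey_tf 1 4 6 = 10"
  unfolding ramsey_tf_def
proof (rule Least_equality)
  show "\<forall>G :: nat pair_pre_digraph. pair_graph G \<and> triangle_free G \<and> card (pverts G) = 10 \<longrightarrow>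
      has_dense_or_sparse 1 4 6 G"
    using ten_vertices by blast
next
  fix n
  assume n: "\<forall>G :: nat pair_pre_digraph. pair_graph G \<and> triangle_free G \<and> card (pverts G) = n \<longrightarrow>
      has_dense_or_sparse 1 4 6 G"
  show "10 \<le> n"
  proof (rule ccontr)
    assume "\<not> 10 \<le> n"
    \<comment> \<open>Minimality needs a counterexample on exactly \<open>n\<close> vertices for
      every \<open>n\<close> below ten: the subgraph of \<open>H\<close> induced by its first
      \<open>n\<close> vertices.\<close>
    then have "{1..n} \<subseteq> pverts graph_H"
      by (simp add: graph_H_def)
    note good = restrict_verts_good[OF graph_H_good this]
    have "card (pverts (restrict_verts graph_H {1..n})) = n"
      by simp
    then show False
      using good n by blast
  qed
qed

theorem theorem4p3:
  shows "ramsey_tf 1 4 6 = 10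
    \<and> (\<forall>G :: 'a pair_pre_digraph.
         pair_graph G \<and> triangle_free G \<and> card (pverts G) = 10
         \<longrightarrow> has_dense_or_sparse 1 4 6 G)
    \<and> extremal_graph 1 4 6 graph_H
    \<and> (\<forall>G :: 'a pair_pre_digraph.
         extremal_graph 1 4 6 G \<longrightarrow> digraph_iso (with_proj G) (with_proj graph_H))"
proof (intro conjI allI impI)
  show "ramsey_tf 1 4 6 = 10"
    by (rule ramsey_tf_1_4_6)
  show "has_dense_or_sparse 1 4 6 G"
    if "pair_graph G \<and> triangle_free G \<and> card (pverts G) = 10" for G :: "'a pair_pre_digraph"
    using that ten_vertices by blast
  show "extremal_graph 1 4 6 graph_H"
    unfolding extremal_graph_def ramsey_tf_1_4_6 using graph_H_good by (simp add: graph_H_def)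
  show "digraph_iso (with_proj G) (with_proj graph_H)"
    if "extremal_graph 1 4 6 G" for G :: "'a pair_pre_digraph"
  proof -
    have G: "pair_graph G" "triangle_free G" "\<not> has_dense_or_sparse 1 4 6 G" "card (pverts G) = 9"
      using that unfolding extremal_graph_def ramsey_tf_1_4_6 by auto
    interpret pair_graph G by fact
    obtain g where "bij_betw g {1..9} (pverts G)" "parcs G = map_prod g g ` parcs graph_H"
      using arcs_eq_map_graph_H G by blast
    moreover have "pverts graph_H = {1..9}" "parcs graph_H \<subseteq> {1..9} \<times> {1..9}"
      using graph_H_good(1) unfolding pair_graph_iff graph_H_def by simp_all
    ultimately show ?thesis
      by (intro with_proj_iso[where g = g]) (auto intro: wf_digraph)
  qed
qed

end
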